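(* If $\mathcal M$ and $\mathcal X\in\mathcal D_L$, where $\mathcal X=[S\ \ G]$, solve (i.e. form a minimizer of) the optimization problem $$\min_{(\mathcal M,\mathcal X)} \ \mathrm{Trace}(\mathcal M\,\mathcal B(\mathcal X))\quad\text{s.t.}\quad \mathcal X\in\mathcal D_L,\quad \mathcal A(\mathcal X)^T\mathcal M+\mathcal M\mathcal A(\mathcal X)+\mathcal C=0,$$ then there exists a symmetric matrix $\mathcal W\in\mathbb R^{(n+\nu)\times(n+\nu)}$ such that the triplet $(\mathcal W,\mathcal M,\mathcal X)$ solves the KKT system $$\begin{cases}\mathcal A(\mathcal X)^T\mathcal M+\mathcal M\mathcal A(\mathcal X)+\mathcal C=0,\\ \mathcal A(\mathcal X)\mathcal W+\mathcal W\mathcal A(\mathcal X)^T+\mathcal B(\mathcal X)=0,\\ M_{12}^TB\mathcal E^T+M_{22}\mathcal X\mathcal E\mathcal E^T+M_{12}^TW_{12}\mathcal L^T+M_{22}W_{22}\mathcal L^T=0.\end{cases}$$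
   Context: Let $A\in\mathbb R^{n\times n}$, $B\in\mathbb R^{n\times m}$, $C\in\mathbb R^{p\times n}$ be a minimal realization of a linear time-invariant system $\dot x=Ax+Bu$, $y=Cx$, with $A$ stable: $\sigma(A)\subset\mathbb C^-$ ($\sigma$ is the spectrum, $\mathbb C^-$ the open left half plane). Fix $L\in\mathbb R^{m\times\nu}$ and a matrix $\Pi\in\mathbb R^{n\times\nu}$ of the form $\Pi=VT$, with $V=[(s_1I-A)^{-1}B\ \cdots\ (s_\nu I-A)^{-1}B]$ (for $m>1$, columns taken along directions $\ell_i\in\mathbb{R}^m$) the right Krylov projection matrix at interpolation points $s_i\notin\sigma(A)$ and $T$ nonsingular; in all formulas $\Pi$ is a fixed constant matrix, not depending on $\mathcal X$. The variable is $\mathcal X=[S\ \ G]\in\mathbb R^{\nu\times(\nu+m)}$ with $S\in\mathbb R^{\nu\times\nu}$, $G\in\mathbb R^{\nu\times m}$. Put $$\mathcal L=\begin{bmatrix}I_\nu\\ -L\end{bmatrix},\qquad \mathcal E=\begin{bmatrix}0_{\nu\times m}\\ I_m\end{bmatrix},$$ so that $G=\mathcal X\mathcal E$ and $S-GL=\mathcal X\mathcal L$. Define $$\mathcal A(\mathcal X)=\begin{bmatrix}A&0\\ 0&\mathcal X\mathcal L\end{bmatrix},\quad \mathcal B(\mathcal X)=\begin{bmatrix}B\\ \mathcal X\mathcal E\end{bmatrix}\begin{bmatrix}B\\ \mathcal X\mathcal E\end{bmatrix}^T,\quad \mathcal C=\begin{bmatrix}I\\ -\Pi^T\end{bmatrix}C^TC\begin{bmatrix}I&-\Pi\end{bmatrix},$$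 and $\mathcal D_L=\{\mathcal X:\sigma(\mathcal X\mathcal L)\subset\mathbb C^-\}$. Symmetric $(n+\nu)\times(n+\nu)$ matrices are partitioned as $\mathcal W=\begin{bmatrix}W_{11}&W_{12}\\ W_{12}^T&W_{22}\end{bmatrix}$, $\mathcal M=\begin{bmatrix}M_{11}&M_{12}\\ M_{12}^T&M_{22}\end{bmatrix}$ with $W_{11},M_{11}\in\mathbb R^{n\times n}$ and $W_{22},M_{22}\in\mathbb R^{\nu\times\nu}$. *)

theory Defs
  imports "HOL-Analysis.Analysis"
begin

text \<open>A matrix with rows indexed by \<open>'r\<close> and columns by \<open>'c\<close> has type \<open>real^'c^'r\<close>; block matrices
  are indexed by sum types.\<close>

definition hcat :: "'a^'c^'r \<Rightarrow> 'a^'d^'r \<Rightarrow> 'a^('c::finite + 'd::finite)^'r" where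
  "hcat P Q = (\<chi> i j. case j of Inl c \<Rightarrow> P $ i $ c | Inr d \<Rightarrow> Q $ i $ d)"

definition vcat :: "'a^'c^'r \<Rightarrow> 'a^'c^'s \<Rightarrow> 'a^'c^('r::finite + 's::finite)" where
  "vcat P Q = (\<chi> i. case i of Inl r \<Rightarrow> P $ r | Inr s \<Rightarrow> Q $ s)"

definition block12 :: "'a^('n::finite + 'v::finite)^('n + 'v) \<Rightarrow> 'a^'v^'n" where
  "block12 M = (\<chi> i j. M $ Inl i $ Inr j)"

definition block22 :: "'a^('n::finite + 'v::finite)^('n + 'v) \<Rightarrow> 'a^'v^'v" where
  "block22 M = (\<chi> i j. M $ Inr i $ Inr j)"

abbreviation cmat :: "real^'c^'r \<Rightarrow> complex^'c^'r" where
  "cmat \<equiv> map_matrix complex_of_real"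

definition spectrum :: "real^'n^'n \<Rightarrow> complex set" where
  "spectrum A = {z. \<not> invertible (mat z - cmat A)}"

definition hurwitz :: "real^'n^'n \<Rightarrow> bool" where
  "hurwitz A \<longleftrightarrow> spectrum A \<subseteq> {z. Re z < 0}"

definition resolvent :: "real^'n^'n \<Rightarrow> complex \<Rightarrow> complex^'n^'n" where
  "resolvent A s = matrix_inv (mat s - cmat A)"

definition transfer :: "real^'n^'n \<Rightarrow> real^'m^'n \<Rightarrow> real^'n^'p \<Rightarrow> complex \<Rightarrow> complex^'m^'p" where
  "transfer A B C s = cmat C ** resolvent A s ** cmat B"

text \<open>Minimality is the absence of a realization of smaller order of the same transfer function.
  The order \<open>k\<close> of a competing realization \<open>(F, G, H)\<close> must be quantified inside the formula,
  so its matrices are functions whose state indices are restricted to \<open>i < k\<close>.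
  If \<open>s\<close> is not an eigenvalue of \<open>F\<close>, then \<open>(s I - F) x = G u\<close> has exactly one solution \<open>x\<close>
  (up to the irrelevant values \<open>x i\<close> for \<open>i \<ge> k\<close>), and \<open>H x\<close> is the value at \<open>u\<close> of the transfer
  function of \<open>(F, G, H)\<close>.\<close>

definition nat_spectrum :: "nat \<Rightarrow> (nat \<Rightarrow> nat \<Rightarrow> real) \<Rightarrow> complex set" where
  "nat_spectrum k F = {s. \<exists>x :: nat \<Rightarrow> complex.
     (\<exists>i<k. x i \<noteq> 0) \<and> (\<forall>i<k. (\<Sum>j<k. complex_of_real (F i j) * x j) = s * x i)}"

definition same_transfer ::
  "real^'n^'n \<Rightarrow> real^'m^'n \<Rightarrow> real^'n^'p \<Rightarrow>
   nat \<Rightarrow> (nat \<Rightarrow> nat \<Rightarrow> real) \<Rightarrow> (nat \<Rightarrow> 'm \<Rightarrow> real) \<Rightarrow> ('p \<Rightarrow> nat \<Rightarrow> real) \<Rightarrow> bool" where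
  "same_transfer A B C k F G H \<longleftrightarrow>
     (\<forall>s. s \<notin> spectrum A \<longrightarrow> s \<notin> nat_spectrum k F \<longrightarrow>
       (\<forall>(u :: complex^'m) (x :: nat \<Rightarrow> complex).
          (\<forall>i<k. s * x i - (\<Sum>j<k. complex_of_real (F i j) * x j)
                 = (\<Sum>l\<in>UNIV. complex_of_real (G i l) * u $ l)) \<longrightarrow>
          (\<forall>q. (\<Sum>j<k. complex_of_real (H q j) * x j) = (transfer A B C s *v u) $ q)))"

definition minimal_realization :: "real^'n^'n \<Rightarrow> real^'m^'n \<Rightarrow> real^'n^'p \<Rightarrow> bool" where
  "minimal_realization A B C \<longleftrightarrow> (\<forall>k F G H. same_transfer A B C k F G H \<longrightarrow> CARD('n) \<le> k)"

text \<open>The interpolation points may be non-real, in which case \<open>V\<close> is complex.\<close>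

definition krylov :: "real^'n^'n \<Rightarrow> real^'m^'n \<Rightarrow> ('v \<Rightarrow> complex) \<Rightarrow> ('v \<Rightarrow> real^'m) \<Rightarrow> complex^'v^'n" where
  "krylov A B s l =
     (\<chi> i j. (resolvent A (s j) *v (cmat B *v (\<chi> a. complex_of_real (l j $ a)))) $ i)"

definition calL :: "real^'v^'m \<Rightarrow> real^'v^('v::finite + 'm::finite)" where
  "calL L = vcat (mat 1) (- L)"

definition calE :: "real^'m^('v::finite + 'm::finite)" where
  "calE = vcat 0 (mat 1)"

definition calA :: "real^'n^'n \<Rightarrow> real^'v^'m \<Rightarrow> real^('v::finite + 'm::finite)^'v
   \<Rightarrow> real^('n::finite + 'v::finite)^('n + 'v)" where
  "calA A L X = vcat (hcat A 0) (hcat 0 (X ** calL L))"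

definition calB :: "real^'m^'n \<Rightarrow> real^('v::finite + 'm::finite)^'v
   \<Rightarrow> real^('n::finite + 'v::finite)^('n + 'v)" where
  "calB B X = vcat B (X ** calE) ** transpose (vcat B (X ** calE))"

definition calC :: "real^'n^'p \<Rightarrow> real^'v^'n \<Rightarrow> real^('n::finite + 'v::finite)^('n + 'v)" where
  "calC C PI = vcat (mat 1) (- transpose PI) ** transpose C ** C ** hcat (mat 1) (- PI)"

definition domD :: "real^'v^'m \<Rightarrow> (real^('v::finite + 'm::finite)^'v) set" where
  "domD L = {X. hurwitz (X ** calL L)}"

definition feasible ::
  "real^'n^'n \<Rightarrow> real^'n^'p \<Rightarrow> real^'v^'m \<Rightarrow> real^'v^'n \<Rightarrow>
   (real^('n::finite + 'v::finite)^('n + 'v)) \<times> (real^('v + 'm::finite)^'v) \<Rightarrow> bool" where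
  "feasible A C L PI = (\<lambda>(M, X). X \<in> domD L \<and>
     transpose (calA A L X) ** M + M ** calA A L X + calC C PI = 0)"

definition objective ::
  "real^'m^'n \<Rightarrow> (real^('n::finite + 'v::finite)^('n + 'v)) \<times> (real^('v + 'm::finite)^'v) \<Rightarrow> real" where
  "objective B = (\<lambda>(M, X). trace (M ** calB B X))"

end

theory Submission
  imports Defs "HOL-Computational_Algebra.Fundamental_Theorem_Algebra"
begin

text \<open>
  For a stable \<open>F\<close> the Lyapunov operator \<open>N \<mapsto> F\<^sup>T N + N F\<close> is bijective, so \<open>M\<close> is symmetric and
  the second KKT equation has a symmetric solution \<open>W\<close>. Stability is an open condition, hence along
  every line \<open>X + t Y\<close> the constraint has a solution \<open>M\<^sub>t\<close> for small \<open>t\<close>, and \<open>M\<^sub>t \<rightarrow> M\<close>. Pairing the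
  constraint with \<open>W\<close> by the adjointness of the two Lyapunov operators shows that the change of the
  objective is exactly \<open>t g(t)\<close>, where \<open>g\<close> is continuous at \<open>0\<close>; no derivative of \<open>M\<^sub>t\<close> is needed.
  Minimality forces \<open>g(0) = 0\<close>, and \<open>g(0)\<close> is twice the inner product of \<open>Y\<close> with the
  left-hand side \<open>R\<close> of the third KKT equation. Taking \<open>Y = R\<close> gives \<open>R = 0\<close>.
\<close>

section \<open>Intertwined matrices without common eigenvalues\<close>

text \<open>The vector q(F) x, evaluated by Horner's scheme, so that no matrix powers have to be
  formed.\<close>

definition poly_act :: "'a::field^'n^'n \<Rightarrow> 'a poly \<Rightarrow> 'a^'n \<Rightarrow> 'a^'n" where
  "poly_act F q x = fold_coeffs (\<lambda>a y. a *s x + F *v y) q 0"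

lemma poly_act_0 [simp]: "poly_act F 0 x = 0"
  by (simp add: poly_act_def)

lemma poly_act_pCons [simp]: "poly_act F (pCons a q) x = a *s x + F *v poly_act F q x"
  by (cases "a = 0 \<and> q = 0") (auto simp: poly_act_def)

lemma poly_act_add: "poly_act F (p + q) x = poly_act F p x + poly_act F q x"
  by (induction p q rule: poly_induct2)
     (simp_all add: matrix_vector_right_distrib vector_sadd_rdistrib algebra_simps)

lemma poly_act_smult: "poly_act F (smult c p) x = c *s poly_act F p x"
  by (induction p)
     (simp_all add: vector_scalar_commute vector_add_ldistrib vector_smult_assoc)

lemma poly_act_sum: "poly_act F (\<Sum>i\<in>I. p i) x = (\<Sum>i\<in>I. poly_act F (p i) x)"
  by (induction I rule: infinite_finite_induct) (simp_all add: poly_act_add)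

lemma poly_act_monom: "poly_act F (monom c i) x = c *s (((*v) F ^^ i) x)"
  by (induction i) (simp_all add: monom_0 monom_Suc vector_scalar_commute)

lemma poly_act_linear_factor:
  "poly_act F ([:- c, 1:] * q) x = F *v poly_act F q x - c *s poly_act F q x"
proof -
  have "[:- c, 1:] * q = pCons 0 q + smult (- c) q" by simp
  then show ?thesis
    by (simp only: poly_act_add poly_act_smult poly_act_pCons) simp
qed

text \<open>Since q(F) commutes with F - c, the factor can be moved onto the argument; this lets an
  induction on the degree continue with the vector \<open>F *v x - c *s x\<close>.\<close>

lemma poly_act_linear_factor_arg:
  "poly_act F ([:- c, 1:] * q) x = poly_act F q (F *v x - c *s x)"
proof -
  have "poly_act F q (x - y) = poly_act F q x - poly_act F q y" for x y
    by (induction q) (simp_all add: matrix_vector_mult_diff_distrib vector_ssub_ldistrib)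
  moreover have "poly_act F q (c *s x) = c *s poly_act F q x"
    by (induction q) (simp_all add: vector_scalar_commute vector_add_ldistrib vector_smult_assoc mult.commute)
  moreover have "poly_act F q (F *v x) = F *v poly_act F q x"
    by (induction q) (simp_all add: vector_scalar_commute matrix_vector_right_distrib)
  ultimately show ?thesis
    by (simp only: poly_act_linear_factor)
qed

text \<open>There is one vector more than the dimension. The claim concerns a family, not a set: if
  two members coincide, their difference is already a nontrivial relation.\<close>

lemma linear_relation_exists:
  fixes f :: "nat \<Rightarrow> 'a::euclidean_space"
  shows "\<exists>c k. c k \<noteq> 0 \<and> k \<le> DIM('a) \<and> (\<Sum>i\<le>DIM('a). c i *\<^sub>R f i) = 0"
proof (cases "inj_on f {..DIM('a)}")
  case True
  then have "card (f ` {..DIM('a)}) > DIM('a)"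
    by (simp add: card_image)
  then have "dependent (f ` {..DIM('a)})"
    using dependent_biggerset by blast
  then obtain u where u: "\<exists>v\<in>f ` {..DIM('a)}. u v \<noteq> 0" "(\<Sum>v\<in>f ` {..DIM('a)}. u v *\<^sub>R v) = 0"
    by (auto simp: real_vector.dependent_finite)
  have "(\<Sum>i\<le>DIM('a). u (f i) *\<^sub>R f i) = 0"
    using u(2) True by (simp add: sum.reindex)
  then show ?thesis
    using u(1) by (intro exI[of _ "u \<circ> f"]) auto
next
  case False
  then obtain i j where ij: "i \<le> DIM('a)" "j \<le> DIM('a)" "i \<noteq> j" "f i = f j"
    by (auto simp: inj_on_def)
  define c :: "nat \<Rightarrow> real" where "c k = (if k = i then 1 else 0) - (if k = j then 1 else 0)" for k
  have "(\<Sum>k\<le>DIM('a). c k *\<^sub>R f k) = f i - f j"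
    using ij(1,2) by (simp add: c_def scaleR_diff_left sum_subtractf if_distrib[of "\<lambda>a. a *\<^sub>R _"] sum.delta cong: if_cong)
  then show ?thesis
    using ij by (intro exI[of _ c] exI[of _ i]) (auto simp: c_def)
qed

lemma vector_scalar_of_real: "complex_of_real c *s x = c *\<^sub>R x"
  by (simp add: vec_eq_iff) (simp add: scaleR_conv_of_real)

text \<open>A linear relation among x, F x, F^2 x, ... up to the real dimension of the space, read
  as a polynomial. Its coefficients happen to be real.\<close>

lemma annihilating_poly_exists:
  fixes F :: "complex^'n^'n"
  shows "\<exists>q. q \<noteq> 0 \<and> poly_act F q x = 0"
proof -
  obtain c k where c: "c k \<noteq> 0" "k \<le> DIM(complex^'n)"
    "(\<Sum>i\<le>DIM(complex^'n). c i *\<^sub>R ((*v) F ^^ i) x) = 0"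
    using linear_relation_exists[of "\<lambda>i. ((*v) F ^^ i) x"] by blast
  define q where "q = (\<Sum>i\<le>DIM(complex^'n). monom (complex_of_real (c i)) i)"
  have "coeff q k = complex_of_real (c k)"
    unfolding q_def using c(2) by (simp add: coeff_sum)
  then have "q \<noteq> 0"
    using c(1) by auto
  moreover have "poly_act F q x = 0"
    unfolding q_def poly_act_sum poly_act_monom vector_scalar_of_real by (rule c(3))
  ultimately show ?thesis
    by blast
qed

text \<open>Every vector \<open>x\<close> is annihilated by some \<open>q(F)\<close> with \<open>q \<noteq> 0\<close>. Of each linear factor \<open>F - c\<close>, either it
  is injective and can be cancelled, or \<open>G - c\<close> is injective and \<open>N x\<close> vanishes as soon as
  \<open>N (F - c) x = (G - c) N x\<close> does.\<close>

lemma intertwining_eq_0: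
  fixes F :: "complex^'n^'n" and G :: "complex^'m^'m" and N :: "complex^'n^'m"
  assumes comm: "N ** F = G ** N"
    and disj: "\<And>c. (\<forall>x. F *v x = c *s x \<longrightarrow> x = 0) \<or> (\<forall>y. G *v y = c *s y \<longrightarrow> y = 0)"
  shows "N = 0"
proof -
  \<comment> \<open>The vector stays arbitrary in the induction because the hypothesis is applied
    once to \<open>x\<close> and once to \<open>F *v x - c *s x\<close>.\<close>
  have *: "N *v x = 0" if "q \<noteq> 0" "poly_act F q x = 0" for q x
    using that
  proof (induction "degree q" arbitrary: q x)
    case 0
    then obtain a where "q = [:a:]"
      by (metis degree_0_id)
    with 0 have "x = 0"
      by (simp add: vector_mul_eq_0)
    then show ?case by simp
  next
    case (Suc d)
    then have "\<not> constant (poly q)"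
      by (simp add: constant_degree)
    then obtain c where "poly q c = 0"
      using fundamental_theorem_of_algebra by blast
    then obtain r where r: "q = [:- c, 1:] * r"
      by (auto simp: poly_eq_0_iff_dvd)
    with Suc.prems have "r \<noteq> 0" by auto
    then have "degree q = Suc (degree r)"
      using r by (subst r, subst degree_mult_eq) auto
    with Suc have d: "d = degree r" by simp
    define y where "y = poly_act F r x"
    have y: "F *v y = c *s y"
      using Suc.prems(2) by (simp only: r poly_act_linear_factor y_def right_minus_eq)
    show ?case
    proof (cases "\<forall>x. F *v x = c *s x \<longrightarrow> x = 0")
      case True
      with y have "y = 0" by blast
      then show ?thesis
        using Suc.hyps(1)[OF d \<open>r \<noteq> 0\<close>] by (simp add: y_def)
    next
      case False
      have "N *v (F *v x - c *s x) = 0"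
        using Suc.hyps(1)[OF d \<open>r \<noteq> 0\<close>] Suc.prems(2) r poly_act_linear_factor_arg by metis
      then have "G *v (N *v x) = c *s (N *v x)"
        by (simp add: matrix_vector_mult_diff_distrib vector_scalar_commute matrix_vector_mul_assoc comm)
      then show ?thesis
        using False disj[of c] by blast
    qed
  qed
  have "N *v x = 0 *v x" for x
    using annihilating_poly_exists[of F x] * by auto
  then show ?thesis
    using matrix_eq by blast
qed

section \<open>Stable matrices\<close>

lemma cmat_mult: "cmat (P ** Q) = cmat P ** cmat Q"
  by (simp add: vec_eq_iff matrix_matrix_mult_def)

lemma cmat_add: "cmat (P + Q) = cmat P + cmat Q"
  by (simp add: vec_eq_iff)

lemma cmat_uminus: "cmat (- P) = - cmat P"
  by (simp add: vec_eq_iff)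

lemma cmat_scaleR: "cmat (c *\<^sub>R P) = c *\<^sub>R cmat P"
  by (simp add: vec_eq_iff) (simp add: scaleR_conv_of_real)

lemma cmat_eq_0_iff: "cmat P = 0 \<longleftrightarrow> P = 0"
  by (simp add: vec_eq_iff)

lemma mat_vector_mult: "mat c *v x = c *s (x :: 'a::semiring_1^'n)"
  by (simp add: vec_eq_iff mat_def matrix_vector_mult_def if_distrib[of "\<lambda>a. a * _"] cong: if_cong)

lemma spectrum_iff_eigenvector: "z \<in> spectrum F \<longleftrightarrow> (\<exists>x. x \<noteq> 0 \<and> cmat F *v x = z *s x)"
proof -
  have "z \<in> spectrum F \<longleftrightarrow> \<not> (\<forall>x. (mat z - cmat F) *v x = 0 \<longrightarrow> x = 0)"
    by (simp add: spectrum_def invertible_left_inverse matrix_left_invertible_ker)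
  then show ?thesis
    by (auto simp: matrix_vector_mult_diff_rdistrib mat_vector_mult)
qed

lemma hurwitz_iff: "hurwitz F \<longleftrightarrow> (\<forall>z x. cmat F *v x = z *s x \<longrightarrow> x \<noteq> 0 \<longrightarrow> Re z < 0)"
  by (auto simp: hurwitz_def spectrum_iff_eigenvector subset_iff)

text \<open>Transposing zI - F preserves invertibility, so no new spectral points arise.\<close>

lemma hurwitz_transpose:
  assumes "hurwitz F" shows "hurwitz (transpose F)"
proof -
  have "mat z - cmat (transpose F) = transpose (mat z - cmat F)" for z
    by (simp add: vec_eq_iff transpose_def mat_def)
  then have "spectrum (transpose F) \<subseteq> spectrum F"
    by (auto simp: spectrum_def invertible_left_inverse)
       (metis invertible_left_inverse invertible_right_inverse left_invertible_transpose)
  then show ?thesis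
    using assms by (auto simp: hurwitz_def)
qed

lemma norm_vector_smult: "norm (c *s x) = norm c * norm (x :: complex^'n)"
  by (simp add: norm_vec_def L2_set_def norm_mult power_mult_distrib real_sqrt_mult flip: sum_distrib_left)

text \<open>\<open>\<parallel>F x - z x\<parallel>\<close> has a positive minimum over unit vectors \<open>x\<close> and the \<open>z\<close> in the closed right half plane
  that are bounded by \<open>K\<^sub>F + K\<^sub>E\<close>, as all eigenvalues of \<open>F + t E\<close> with \<open>\<bar>t\<bar> \<le> 1\<close> are.\<close>

lemma hurwitz_perturb:
  fixes F E :: "real^'n^'n"
  assumes "hurwitz F"
  shows "\<forall>\<^sub>F t in at 0. hurwitz (F + t *\<^sub>R E)"
proof -
  obtain KF where KF: "KF > 0" "\<And>x. norm (cmat F *v x) \<le> KF * norm x"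
    using linear_bounded_pos[OF matrix_vector_mul_linear[of "cmat F"]] by blast
  obtain KE where KE: "KE > 0" "\<And>x. norm (cmat E *v x) \<le> KE * norm x"
    using linear_bounded_pos[OF matrix_vector_mul_linear[of "cmat E"]] by blast
  define S where "S = sphere (0 :: complex^'n) 1 \<times> (cball (0::complex) (KF + KE) \<inter> {z. Re z \<ge> 0})"
  define h where "h = (\<lambda>(x, z). norm (cmat F *v x - z *s x))"
  have "closed {z. Re z \<ge> 0}"
    by (intro closed_Collect_le continuous_intros)
  then have "compact S"
    unfolding S_def by (intro compact_Times compact_Int_closed) auto
  have "continuous_on S (\<lambda>p. \<chi> i. snd p * fst p $ i)"
    by (intro continuous_intros)
  then have "continuous_on S (\<lambda>p. snd p *s fst p)"
    by (simp add: vector_scalar_mult_def)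
  moreover have "continuous_on S (\<lambda>p. cmat F *v fst p)"
    by (intro bounded_linear.continuous_on[OF matrix_vector_mul_bounded_linear] continuous_intros)
  ultimately have "continuous_on S h"
    unfolding h_def case_prod_unfold by (intro continuous_intros)
  obtain e :: "complex^'n" where "norm e = 1"
    using vector_choose_size[of 1] by auto
  then have "(e, 0) \<in> S"
    using KF(1) KE(1) by (simp add: S_def)
  then have "S \<noteq> {}" by blast
  obtain p where p: "p \<in> S" "\<And>q. q \<in> S \<Longrightarrow> h p \<le> h q"
    using continuous_attains_inf[OF \<open>compact S\<close> \<open>S \<noteq> {}\<close> \<open>continuous_on S h\<close>] by blast
  \<comment> \<open>A zero of \<open>h\<close> on \<open>S\<close> would be a unit eigenvector of
    \<open>F\<close> whose eigenvalue has nonnegative real part.\<close>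
  have "h p > 0"
    using p(1) assms by (fastforce simp: h_def S_def hurwitz_iff)
  \<comment> \<open>The bound 1 keeps a hypothetical unstable eigenpair inside \<open>S\<close>; the
    bound \<open>h p / KE\<close> makes the perturbation smaller than the minimum of
    \<open>h\<close>, a contradiction.\<close>
  have "hurwitz (F + t *\<^sub>R E)" if t: "\<bar>t\<bar> < min 1 (h p / KE)" for t
    unfolding hurwitz_iff
  proof (intro allI impI, rule ccontr)
    fix z and x0 :: "complex^'n"
    assume eig0: "cmat (F + t *\<^sub>R E) *v x0 = z *s x0" and "x0 \<noteq> 0" and "\<not> Re z < 0"
    define x where "x = complex_of_real (1 / norm x0) *s x0"
    have nx: "norm x = 1"
      using \<open>x0 \<noteq> 0\<close> by (simp add: x_def norm_vector_smult norm_divide)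
    have "cmat (F + t *\<^sub>R E) *v x = z *s x"
      unfolding x_def vector_scalar_commute eig0 by (simp add: vector_smult_assoc mult.commute)
    moreover have "(t *\<^sub>R cmat E) *v x = t *\<^sub>R (cmat E *v x)"
      by (simp add: vec_eq_iff matrix_vector_mult_def scaleR_sum_right)
    ultimately have eig: "cmat F *v x + t *\<^sub>R (cmat E *v x) = z *s x"
      by (simp add: cmat_add cmat_scaleR matrix_vector_mult_add_rdistrib)
    have tE: "norm (t *\<^sub>R (cmat E *v x)) \<le> \<bar>t\<bar> * KE"
      using KE(2)[of x] nx by (simp add: mult_left_mono)
    have "norm z = norm (z *s x)"
      by (simp add: norm_vector_smult nx)
    also have "\<dots> \<le> KF + \<bar>t\<bar> * KE"
      using norm_triangle_ineq[of "cmat F *v x" "t *\<^sub>R (cmat E *v x)"] tE KF(2)[of x] nx eig by simp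
    also have "\<dots> \<le> KF + KE"
      using t KE(1) by simp
    finally have "(x, z) \<in> S"
      using nx \<open>\<not> Re z < 0\<close> by (simp add: S_def)
    then have "h p \<le> norm (cmat F *v x - z *s x)"
      using p(2)[of "(x, z)"] by (simp add: h_def)
    also have "cmat F *v x - z *s x = - (t *\<^sub>R (cmat E *v x))"
      using eig by (simp add: algebra_simps flip: eig)
    also have "norm (- (t *\<^sub>R (cmat E *v x))) \<le> \<bar>t\<bar> * KE"
      using tE by simp
    also have "\<dots> < h p"
      using t KE(1) by (simp add: pos_less_divide_eq)
    finally show False by simp
  qed
  then show ?thesis
    unfolding eventually_at using \<open>h p > 0\<close> KE(1)
    by (intro exI[of _ "min 1 (h p / KE)"]) auto
qed

lemma sum_UNIV_Plus:
  fixes f :: "'a::finite + 'b::finite \<Rightarrow> 'c::comm_monoid_add"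
  shows "(\<Sum>k\<in>UNIV. f k) = (\<Sum>a\<in>UNIV. f (Inl a)) + (\<Sum>b\<in>UNIV. f (Inr b))"
  using sum.Plus[of UNIV UNIV f] by (simp add: comp_def)

text \<open>An eigenvector splits into two parts, each satisfying the eigenvalue equation of its
  block, and at least one part is nonzero.\<close>

lemma hurwitz_block_diag:
  assumes "hurwitz P" and "hurwitz Q"
  shows "hurwitz (vcat (hcat P 0) (hcat 0 Q))"
  unfolding hurwitz_iff
proof (intro allI impI)
  fix z and x :: "complex^('a + 'b)"
  assume eig: "cmat (vcat (hcat P 0) (hcat 0 Q)) *v x = z *s x" and "x \<noteq> 0"
  define x1 x2 where "x1 = (\<chi> i. x $ Inl i)" and "x2 = (\<chi> i. x $ Inr i)"
  have "cmat P *v x1 = z *s x1"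
  proof (subst vec_eq_iff, rule allI)
    fix i show "(cmat P *v x1) $ i = (z *s x1) $ i"
      using arg_cong[OF eig, of "\<lambda>v. v $ Inl i"]
      by (simp add: matrix_vector_mult_def sum_UNIV_Plus vcat_def hcat_def x1_def)
  qed
  moreover have "cmat Q *v x2 = z *s x2"
  proof (subst vec_eq_iff, rule allI)
    fix i show "(cmat Q *v x2) $ i = (z *s x2) $ i"
      using arg_cong[OF eig, of "\<lambda>v. v $ Inr i"]
      by (simp add: matrix_vector_mult_def sum_UNIV_Plus vcat_def hcat_def x2_def)
  qed
  moreover obtain k where "x $ k \<noteq> 0"
    using \<open>x \<noteq> 0\<close> by (auto simp: vec_eq_iff)
  then have "x1 \<noteq> 0 \<or> x2 \<noteq> 0"
    by (cases k) (auto simp: x1_def x2_def vec_eq_iff)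
  ultimately show "Re z < 0"
    using assms by (auto simp: hurwitz_iff)
qed

section \<open>Algebra of sums, negatives, transposes and scalar multiples\<close>

lemma matrix_add_rdistrib: "(P + Q) ** R = P ** R + (Q :: 'a::semiring_1^'k^'n) ** R"
  by (simp add: matrix_matrix_mult_def vec_eq_iff sum.distrib algebra_simps)

lemma matrix_uminus_left: "(- P) ** R = - ((P :: 'a::ring_1^'k^'n) ** R)"
  by (simp add: matrix_matrix_mult_def vec_eq_iff sum_negf)

lemma transpose_add: "transpose (P + Q) = transpose P + transpose Q"
  by (simp add: transpose_def vec_eq_iff)

lemma transpose_uminus: "transpose (- P) = - transpose P"
  by (simp add: transpose_def vec_eq_iff)

lemma transpose_zero: "transpose 0 = 0"
  by (simp add: transpose_def vec_eq_iff)

lemma matrix_scaleR_left: "(c *\<^sub>R P) ** Q = c *\<^sub>R (P ** (Q :: real^'k^'n))"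
  by (simp add: matrix_matrix_mult_def vec_eq_iff sum_distrib_left mult.assoc)

lemma matrix_scaleR_right: "P ** (c *\<^sub>R Q) = c *\<^sub>R (P ** (Q :: real^'k^'n))"
  by (simp add: matrix_matrix_mult_def vec_eq_iff sum_distrib_left mult_ac)

section \<open>The Lyapunov operator\<close>

text \<open>This is the operator of the first KKT equation; that of the second is
  \<open>lyap (transpose F)\<close>.\<close>

definition lyap :: "real^'n^'n \<Rightarrow> real^'n^'n \<Rightarrow> real^'n^'n" where
  "lyap F N = transpose F ** N + N ** F"

lemma linear_lyap: "linear (lyap F)"
  by (intro linearI)
     (simp_all add: lyap_def matrix_add_ldistrib matrix_add_rdistrib matrix_scaleR_left matrix_scaleR_right
        scaleR_add_right)

text \<open>A kernel element \<open>N\<close> intertwines \<open>F\<close> with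
  \<open>- transpose F\<close>. The eigenvalues of the former lie in the open left half plane, those
  of the latter in the open right one, so \<open>intertwining_eq_0\<close> applies.\<close>

lemma inj_lyap:
  assumes "hurwitz F"
  shows "inj (lyap F)"
proof -
  have "N = 0" if "lyap F N = 0" for N
  proof -
    have "N ** F = (- transpose F) ** N"
      using that by (simp add: lyap_def matrix_uminus_left add_eq_0_iff)
    then have "cmat N ** cmat F = (- cmat (transpose F)) ** cmat N"
      by (metis cmat_mult cmat_uminus)
    moreover have "(\<forall>x. cmat F *v x = c *s x \<longrightarrow> x = 0) \<or>
        (\<forall>y. (- cmat (transpose F)) *v y = c *s y \<longrightarrow> y = 0)" for c
    proof (cases "Re c < 0")
      case False
      then show ?thesis using assms by (auto simp: hurwitz_iff)
    next
      case True
      have "y = 0" if "(- cmat (transpose F)) *v y = c *s y" for y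
      proof (rule ccontr)
        assume "y \<noteq> 0"
        have "(- cmat (transpose F)) *v y = - (cmat (transpose F) *v y)"
          using matrix_vector_mult_diff_rdistrib[of 0 "cmat (transpose F)" y] by (simp del: transpose_matrix_vector)
        then have "cmat (transpose F) *v y = (- c) *s y"
          using that by (simp add: minus_equation_iff[of "c *s y"] del: transpose_matrix_vector)
        then have "Re (- c) < 0"
          using hurwitz_transpose[OF assms] \<open>y \<noteq> 0\<close> unfolding hurwitz_iff by blast
        with True show False by simp
      qed
      then show ?thesis by blast
    qed
    ultimately have "cmat N = 0"
      by (rule intertwining_eq_0)
    then show ?thesis
      by (simp add: cmat_eq_0_iff)
  qed
  then show ?thesis
    using linear_injective_0[OF linear_lyap] by blast
qed

lemma surj_lyap: "inj (lyap F) \<Longrightarrow> surj (lyap F)"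
  by (rule eucl.linear_inj_imp_surj[OF linear_lyap])

text \<open>\<open>transpose N\<close> solves the same equation as \<open>N\<close>, and the
  solution is unique.\<close>

lemma lyap_symmetric:
  assumes "hurwitz F" and "transpose (lyap F N) = lyap F N"
  shows "transpose N = N"
proof -
  have "lyap F (transpose N) = transpose (lyap F N)"
    by (simp add: lyap_def transpose_add matrix_transpose_mul add.commute)
  then show ?thesis
    using assms inj_lyap[OF assms(1)] by (simp add: inj_eq)
qed

lemma lyap_add_scaleR: "lyap (F + t *\<^sub>R D) N = lyap F N + t *\<^sub>R lyap D N"
  by (simp add: lyap_def transpose_add transpose_scalar matrix_add_rdistrib matrix_add_ldistrib
      matrix_scaleR_left matrix_scaleR_right scaleR_add_right)

text \<open>By cyclicity of the trace, \<open>transpose F\<close> moves from the left of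
  \<open>N\<close> to the right of \<open>W\<close>.\<close>

lemma trace_lyap_adjoint: "trace (lyap F N ** W) = trace (N ** lyap (transpose F) W)"
proof -
  have "trace (transpose F ** N ** W) = trace (N ** W ** transpose F)"
    using trace_mul_sym[of "transpose F" "N ** W"] by (simp add: matrix_mul_assoc)
  then show ?thesis
    by (simp add: lyap_def matrix_add_rdistrib matrix_add_ldistrib trace_add matrix_mul_assoc)
qed

lemma trace_scaleR: "trace (c *\<^sub>R P) = c * trace (P :: real^'n^'n)"
  by (simp add: trace_def sum_distrib_left)

lemma trace_uminus: "trace (- P) = - trace (P :: 'a::comm_ring_1^'n^'n)"
  by (simp add: trace_def sum_negf)

lemma trace_transpose: "trace (transpose P) = trace P"
  by (simp add: trace_def transpose_def)

lemma matrix_uminus_right: "P ** (- R) = - ((P :: 'a::ring_1^'k^'n) ** R)"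
  by (simp add: matrix_matrix_mult_def vec_eq_iff sum_negf)

lemma linear_trace_mult_left: "linear (\<lambda>N :: real^'n^'m. trace (N ** P))"
  by (intro linearI)
     (simp_all add: matrix_add_rdistrib trace_add matrix_scaleR_left trace_scaleR)

lemma tendsto_trace_mult_left:
  fixes N :: "'a \<Rightarrow> real^'n^'m"
  assumes "(N \<longlongrightarrow> M) G"
  shows "((\<lambda>t. trace (N t ** P)) \<longlongrightarrow> trace (M ** P)) G"
  by (rule bounded_linear.tendsto[OF linear_conv_bounded_linear[THEN iffD1, OF linear_trace_mult_left] assms])

text \<open>Injectivity bounds \<open>lyap F\<close> below by some \<open>c > 0\<close>. As
  \<open>lyap\<close> is linear in the matrix \<open>F\<close>, the error solves
  \<open>lyap F E = - t lyap D M - t lyap D E\<close>; for small \<open>t\<close> the last term is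
  absorbed, leaving an error of order \<open>t\<close>.\<close>

lemma lyap_solution_continuous:
  assumes "hurwitz F" and "lyap F M = Q"
  shows "\<exists>N. (\<forall>\<^sub>F t in at 0. lyap (F + t *\<^sub>R D) (N t) = Q) \<and> (N \<longlongrightarrow> M) (at 0)"
proof -
  obtain c where c: "c > 0" "\<And>N. norm (lyap F N) \<ge> c * norm N"
    using linear_inj_bounded_below_pos[OF linear_lyap inj_lyap[OF assms(1)]] by blast
  obtain K where K: "K > 0" "\<And>N. norm (lyap D N) \<le> K * norm N"
    using linear_bounded_pos[OF linear_lyap] by blast
  \<comment> \<open>The value of \<open>inv\<close> matters only for small \<open>t\<close>, where
    the operator is bijective.\<close>
  define N where "N t = inv (lyap (F + t *\<^sub>R D)) Q" for t
  have sol: "\<forall>\<^sub>F t in at 0. lyap (F + t *\<^sub>R D) (N t) = Q"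
    using hurwitz_perturb[OF assms(1), of D]
    by eventually_elim (simp add: N_def surj_f_inv_f surj_lyap inj_lyap)
  \<comment> \<open>With this radius the term \<open>t lyap D E\<close> costs at most half of the
    lower bound \<open>c * norm E\<close>.\<close>
  have small: "\<forall>\<^sub>F t in at (0::real). \<bar>t\<bar> < c / (2 * K)"
    unfolding eventually_at using c(1) K(1) by (intro exI[of _ "c / (2 * K)"]) auto
  have "\<forall>\<^sub>F t in at 0. norm (N t - M) \<le> \<bar>t\<bar> * (2 / c * norm (lyap D M))"
    using sol small
  proof eventually_elim
    case (elim t)
    define E where "E = N t - M"
    have "lyap F E + t *\<^sub>R lyap D E = - (t *\<^sub>R lyap D M)"
      using elim(1) assms(2)
      by (simp add: E_def lyap_add_scaleR linear_diff[OF linear_lyap] algebra_simps)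
    then have "lyap F E = - (t *\<^sub>R lyap D M) - t *\<^sub>R lyap D E"
      by (simp add: eq_diff_eq)
    then have "norm (lyap F E) \<le> norm (t *\<^sub>R lyap D M) + norm (t *\<^sub>R lyap D E)"
      using norm_triangle_ineq4[of "- (t *\<^sub>R lyap D M)" "t *\<^sub>R lyap D E"] by (simp del: norm_scaleR)
    then have "c * norm E \<le> \<bar>t\<bar> * norm (lyap D M) + \<bar>t\<bar> * norm (lyap D E)"
      using c(2)[of E] by simp
    also have "\<bar>t\<bar> * norm (lyap D E) \<le> \<bar>t\<bar> * (K * norm E)"
      using K(2) by (intro mult_left_mono) auto
    also have "\<bar>t\<bar> * (K * norm E) \<le> c / 2 * norm E"
      using elim(2) K(1) mult_right_mono[of "\<bar>t\<bar> * K" "c / 2" "norm E"]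
      by (simp add: field_simps)
    finally have "norm E * c \<le> 2 * (\<bar>t\<bar> * norm (lyap D M))"
      by (simp add: mult.commute)
    then have "norm E \<le> 2 * (\<bar>t\<bar> * norm (lyap D M)) / c"
      using c(1) by (simp add: pos_le_divide_eq)
    then show ?case
      using c(1) by (simp add: E_def mult_ac)
  qed
  moreover have "((\<lambda>t. \<bar>t\<bar> * (2 / c * norm (lyap D M))) \<longlongrightarrow> 0) (at 0)"
    by (intro tendsto_mult_left_zero tendsto_rabs_zero tendsto_ident_at)
  ultimately have "((\<lambda>t. N t - M) \<longlongrightarrow> 0) (at 0)"
    by (rule Lim_null_comparison)
  then show ?thesis
    using sol Lim_null by blast
qed

text \<open>The trace that vanishes is the directional derivative of the objective at
  \<open>t = 0\<close>; \<open>B0\<close>, \<open>B1\<close>, \<open>B2\<close> are the coefficients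
  of the quadratic input term along the line, and \<open>W\<close> is the multiplier of the Lyapunov
  constraint.\<close>

lemma lyap_trace_stationary:
  assumes "hurwitz F" and "lyap F M = - Q" and "lyap (transpose F) W = - B0"
    and min: "\<forall>\<^sub>F t in at 0. \<forall>N. lyap (F + t *\<^sub>R D) N = - Q \<longrightarrow>
      trace (M ** B0) \<le> trace (N ** (B0 + t *\<^sub>R B1 + t\<^sup>2 *\<^sub>R B2))"
  shows "trace (M ** (D ** W + W ** transpose D + B1)) = 0"
proof -
  obtain N where N: "\<forall>\<^sub>F t in at 0. lyap (F + t *\<^sub>R D) (N t) = - Q" "(N \<longlongrightarrow> M) (at 0)"
    using lyap_solution_continuous[OF assms(1,2)] by blast
  define P where "P = D ** W + W ** transpose D + B1"
  \<comment> \<open>The difference quotient of the objective along the solutions \<open>N t\<close>,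
    rewritten so that it also makes sense at \<open>t = 0\<close>.\<close>
  define g where "g t = trace (N t ** P) + t * trace (N t ** B2)" for t
  have "(g \<longlongrightarrow> trace (M ** P) + 0 * trace (M ** B2)) (at 0)"
    unfolding g_def by (intro tendsto_intros tendsto_trace_mult_left N(2))
  then have lim: "(g \<longlongrightarrow> trace (M ** P)) (at 0)"
    by simp
  have "\<forall>\<^sub>F t in at 0. 0 \<le> t * g t"
    using N(1) min
  proof eventually_elim
    case (elim t)
    \<comment> \<open>Both constraints have right-hand side \<open>- Q\<close>. After pairing with
      \<open>W\<close>, the equation for \<open>W\<close> turns the terms in \<open>lyap F\<close>
      into the objective with \<open>B0\<close>.\<close>
    have "trace (lyap (F + t *\<^sub>R D) (N t) ** W) = trace (lyap F M ** W)"
      using elim(1) assms(2) by simp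
    then have "trace (lyap F (N t) ** W) + t * trace (lyap D (N t) ** W) = trace (lyap F M ** W)"
      by (simp add: lyap_add_scaleR matrix_add_rdistrib matrix_scaleR_left trace_add trace_scaleR)
    then have "trace (N t ** B0) - trace (M ** B0) = t * trace (N t ** lyap (transpose D) W)"
      by (simp add: trace_lyap_adjoint assms(3) matrix_uminus_right trace_uminus)
    moreover have "trace (N t ** (B0 + t *\<^sub>R B1 + t\<^sup>2 *\<^sub>R B2))
        = trace (N t ** B0) + t * trace (N t ** B1) + t\<^sup>2 * trace (N t ** B2)"
      by (simp add: matrix_add_ldistrib matrix_scaleR_right trace_add trace_scaleR)
    moreover have "trace (M ** B0) \<le> trace (N t ** (B0 + t *\<^sub>R B1 + t\<^sup>2 *\<^sub>R B2))"
      using elim by blast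
    moreover have "trace (N t ** P) = trace (N t ** lyap (transpose D) W) + trace (N t ** B1)"
      by (simp add: P_def lyap_def matrix_add_ldistrib trace_add)
    ultimately show ?case
      by (simp add: g_def algebra_simps power2_eq_square)
  qed
  \<comment> \<open>Dividing by \<open>t\<close> gives opposite signs of \<open>g\<close> on the two
    sides of 0, so the common limit is both nonnegative and nonpositive.\<close>
  then have ev: "\<forall>\<^sub>F t in at_left 0. 0 \<le> t * g t" "\<forall>\<^sub>F t in at_right 0. 0 \<le> t * g t"
    by (simp_all add: eventually_at_split)
  have lims: "(g \<longlongrightarrow> trace (M ** P)) (at_left 0)" "(g \<longlongrightarrow> trace (M ** P)) (at_right 0)"
    using lim by (simp_all add: filterlim_at_split)
  have "\<forall>\<^sub>F t in at_right 0. 0 \<le> g t"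
    using ev(2) eventually_at_right_less[of 0]
    by eventually_elim (simp add: zero_le_mult_iff)
  then have "0 \<le> trace (M ** P)"
    using tendsto_lowerbound[OF lims(2)] by simp
  have "\<forall>\<^sub>F t in at_left (0::real). t < 0"
    by (simp add: eventually_at_filter)
  with ev(1) have "\<forall>\<^sub>F t in at_left 0. g t \<le> 0"
    by eventually_elim (simp add: zero_le_mult_iff)
  then have "trace (M ** P) \<le> 0"
    using tendsto_upperbound[OF lims(1)] by simp
  with \<open>0 \<le> trace (M ** P)\<close> show ?thesis
    by (simp add: P_def)
qed

section \<open>Block matrices\<close>

text \<open>The trace is the sum of the squares of all entries of \<open>P\<close>.\<close>

lemma trace_transpose_mult_self_eq_0:
  fixes P :: "real^'n^'m"
  assumes "trace (transpose P ** P) = 0"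
  shows "P = 0"
proof -
  have "(\<Sum>i\<in>UNIV. \<Sum>k\<in>UNIV. P $ k $ i * P $ k $ i) = 0"
    using assms by (simp add: trace_def transpose_def matrix_matrix_mult_def)
  then have "\<forall>i. \<forall>k. P $ k $ i * P $ k $ i = 0"
    by (simp add: sum_nonneg_eq_0_iff sum_nonneg)
  then show ?thesis
    by (simp add: vec_eq_iff)
qed

section \<open>Products and transposes of block matrices\<close>

lemma vcat_mult: "vcat P Q ** R = vcat (P ** R) (Q ** R)"
  by (simp add: vec_eq_iff vcat_def matrix_matrix_mult_def split: sum.split)

lemma mult_hcat: "R ** hcat P Q = hcat (R ** P) (R ** Q)"
  by (simp add: vec_eq_iff hcat_def matrix_matrix_mult_def split: sum.split)

lemma hcat_mult_vcat: "hcat P Q ** vcat R S = P ** R + Q ** S"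
  by (simp add: vec_eq_iff hcat_def vcat_def matrix_matrix_mult_def sum_UNIV_Plus)

lemma transpose_vcat: "transpose (vcat P Q) = hcat (transpose P) (transpose Q)"
  by (simp add: vec_eq_iff hcat_def vcat_def transpose_def split: sum.split)

lemma transpose_hcat: "transpose (hcat P Q) = vcat (transpose P) (transpose Q)"
  by (simp add: vec_eq_iff hcat_def vcat_def transpose_def split: sum.split)

lemma vcat_add_scaleR:
  "vcat P Q + c *\<^sub>R vcat R S = vcat (P + c *\<^sub>R R) (Q + c *\<^sub>R (S :: real^'c^'s))"
  by (simp add: vec_eq_iff vcat_def split: sum.split)

lemma hcat_add_scaleR:
  "hcat P Q + c *\<^sub>R hcat R S = hcat (P + c *\<^sub>R R) (Q + c *\<^sub>R (S :: real^'c^'s))"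
  by (simp add: vec_eq_iff hcat_def split: sum.split)

lemma matrix_mult_0_left: "0 ** P = (0 :: 'a::semiring_1^'n^'m)"
  by (simp add: vec_eq_iff matrix_matrix_mult_def)

lemma matrix_mult_0_right: "P ** 0 = (0 :: 'a::semiring_1^'n^'m)"
  by (simp add: vec_eq_iff matrix_matrix_mult_def)

text \<open>Right multiplication by \<open>vcat 0 (mat 1)\<close> selects the second block
  column.\<close>

lemma split_cols_lower:
  assumes "transpose M = (M :: real^('n::finite + 'v::finite)^('n + 'v))"
  shows "M ** vcat 0 (mat 1) = vcat (block12 M) (block22 M)"
  by (simp add: vec_eq_iff vcat_def block12_def block22_def matrix_matrix_mult_def sum_UNIV_Plus mat_def
      if_distrib[of "\<lambda>a. _ * a"] cong: if_cong split: sum.split)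

text \<open>Only the lower right block depends on \<open>X\<close>, and it does so linearly;
  conjugation by \<open>J\<close> puts a matrix into that block.\<close>

lemma calA_perturb:
  fixes A :: "real^'n^'n" and L :: "real^'v^'m" and X Y :: "real^('v::finite + 'm::finite)^'v"
  defines "J \<equiv> vcat 0 (mat 1) :: real^'v^('n + 'v)"
  shows "calA A L (X + t *\<^sub>R Y) = calA A L X + t *\<^sub>R (J ** (Y ** calL L) ** transpose J)"
proof -
  have "J ** P ** transpose J = vcat 0 (P ** transpose J)" for P
    by (simp add: J_def vcat_mult matrix_mult_0_left)
  moreover have "P ** transpose J = hcat 0 P" for P :: "real^'v^'v"
    by (simp add: J_def transpose_vcat transpose_zero mult_hcat matrix_mult_0_right)
  ultimately show ?thesis
    by (simp add: calA_def vcat_add_scaleR hcat_add_scaleR matrix_add_rdistrib matrix_scaleR_left)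
qed

text \<open>The factor of \<open>calB\<close> moves from \<open>b\<close> to \<open>b + t d\<close>;
  expanding its product with its transpose gives the quadratic in \<open>t\<close>.\<close>

lemma calB_perturb:
  fixes B :: "real^'m^'n" and X Y :: "real^('v::finite + 'm::finite)^'v"
  defines "b \<equiv> vcat B (X ** calE)" and "d \<equiv> vcat 0 (mat 1) ** Y ** calE"
  shows "calB B (X + t *\<^sub>R Y) = calB B X + t *\<^sub>R (d ** transpose b + b ** transpose d)
    + t\<^sup>2 *\<^sub>R (d ** transpose d)"
proof -
  have "vcat B ((X + t *\<^sub>R Y) ** calE) = b + t *\<^sub>R d"
    by (simp add: b_def d_def vcat_mult vcat_add_scaleR matrix_mult_0_left matrix_add_rdistrib
        matrix_scaleR_left)
  then show ?thesis
    by (simp add: calB_def transpose_add transpose_scalar matrix_add_rdistrib matrix_add_ldistrib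
        matrix_scaleR_left matrix_scaleR_right scaleR_add_right power2_eq_square flip: b_def)
qed

section \<open>The KKT system\<close>

theorem lemma3p3:
  fixes A :: "real^'n^'n" and B :: "real^'m^'n" and C :: "real^'n^'p"
    and L :: "real^'v^'m" and PI :: "real^'v^'n"
    and s :: "'v \<Rightarrow> complex" and l :: "'v \<Rightarrow> real^'m" and T :: "complex^'v^'v"
    and M :: "real^('n::finite + 'v::finite)^('n + 'v)" and X :: "real^('v::finite + 'm::finite)^'v"
  assumes "minimal_realization A B C"
    and "hurwitz A"
    and "\<And>j. s j \<notin> spectrum A"
    and "invertible T"
    and "cmat PI = krylov A B s l ** T"
    and "is_arg_min (objective B) (feasible A C L PI) (M, X)"
  shows "\<exists>W :: real^('n::finite + 'v::finite)^('n + 'v). transpose W = W \<and>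
    transpose (calA A L X) ** M + M ** calA A L X + calC C PI = 0 \<and>
    calA A L X ** W + W ** transpose (calA A L X) + calB B X = 0 \<and>
    transpose (block12 M) ** B ** transpose calE
      + block22 M ** X ** calE ** transpose calE
      + transpose (block12 M) ** block12 W ** transpose (calL L)
      + block22 M ** block22 W ** transpose (calL L) = 0"
proof -
  define F where "F = calA A L X"
  define Q :: "real^('n + 'v)^('n + 'v)" where "Q = calC C PI"
  define b where "b = vcat B (X ** calE)"
  define J where "J = (vcat 0 (mat 1) :: real^'v^('n + 'v))"
  have "hurwitz (X ** calL L)" and kkt1: "transpose F ** M + M ** F + Q = 0"
    using assms(6) by (auto simp: is_arg_min_def feasible_def domD_def F_def Q_def)
  then have hF: "hurwitz F"
    using hurwitz_block_diag[OF assms(2)] by (simp add: F_def calA_def)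
  have lyapM: "lyap F M = - Q"
    using kkt1 by (simp add: lyap_def eq_neg_iff_add_eq_0)
  have "Q = transpose (C ** hcat (mat 1) (- PI)) ** (C ** hcat (mat 1) (- PI))"
    by (simp add: Q_def calC_def matrix_transpose_mul transpose_hcat transpose_uminus matrix_mul_assoc)
  then have "transpose Q = Q"
    by (simp add: matrix_transpose_mul matrix_mul_assoc)
  then have symM: "transpose M = M"
    using lyap_symmetric[OF hF, of M] by (simp add: lyapM transpose_uminus)
  obtain W where "- calB B X = lyap (transpose F) W"
    using surjE[OF surj_lyap[OF inj_lyap[OF hurwitz_transpose[OF hF]]]] by blast
  then have lyapW: "lyap (transpose F) W = - calB B X" by (rule sym)
  have "transpose (calB B X) = calB B X"
    by (simp add: calB_def matrix_transpose_mul)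
  then have symW: "transpose W = W"
    using lyap_symmetric[OF hurwitz_transpose[OF hF], of W] by (simp add: lyapW transpose_uminus)
  \<comment> \<open>With this \<open>K\<close>, half the derivative of the objective in direction
    \<open>Y\<close> is \<open>trace (M ** J ** Y ** K)\<close>. By cyclicity the choice of
    \<open>Y\<close> below makes it the squared Frobenius norm of
    \<open>K ** M ** J\<close>.\<close>
  define K where "K = calL L ** transpose J ** W + calE ** transpose b"
  define Y where "Y = transpose (K ** M ** J)"
  define D where "D = J ** (Y ** calL L) ** transpose J"
  define d where "d = J ** Y ** calE"
  have "trace (M ** (D ** W + W ** transpose D + (d ** transpose b + b ** transpose d))) = 0"
  proof (rule lyap_trace_stationary[OF hF lyapM lyapW])
    show "\<forall>\<^sub>F t in at 0. \<forall>N. lyap (F + t *\<^sub>R D) N = - Q \<longrightarrow> trace (M ** calB B X)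
        \<le> trace (N ** (calB B X + t *\<^sub>R (d ** transpose b + b ** transpose d) + t\<^sup>2 *\<^sub>R (d ** transpose d)))"
      \<comment> \<open>Stability of the reduced block suffices for feasibility of
        \<open>X + t Y\<close>; any solution \<open>N\<close> of the perturbed constraint then
        competes with \<open>M\<close>.\<close>
      using hurwitz_perturb[OF \<open>hurwitz (X ** calL L)\<close>, of "Y ** calL L"]
    proof eventually_elim
      case (elim t)
      have X': "X + t *\<^sub>R Y \<in> domD L"
        using elim by (simp add: domD_def matrix_add_rdistrib matrix_scaleR_left)
      have A': "calA A L (X + t *\<^sub>R Y) = F + t *\<^sub>R D"
        unfolding F_def D_def J_def by (rule calA_perturb)
      have B': "calB B (X + t *\<^sub>R Y) = calB B X + t *\<^sub>R (d ** transpose b + b ** transpose d)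
          + t\<^sup>2 *\<^sub>R (d ** transpose d)"
        unfolding b_def d_def J_def by (rule calB_perturb)
      have "trace (M ** calB B X) \<le> trace (N ** calB B (X + t *\<^sub>R Y))"
        if N: "lyap (F + t *\<^sub>R D) N = - Q" for N
      proof -
        have "feasible A C L PI (N, X + t *\<^sub>R Y)"
          using X' N by (simp add: feasible_def A' lyap_def Q_def)
        then show ?thesis
          using assms(6) by (auto simp: is_arg_min_def objective_def not_less)
      qed
      then show ?case
        unfolding B' by blast
    qed
  qed
  \<comment> \<open>By symmetry of \<open>M\<close> and \<open>W\<close> the terms of the derivative
    are equal in pairs, which gives only a factor 2.\<close>
  moreover have "trace (M ** (W ** transpose D)) = trace (M ** (D ** W))"
  proof -
    have "trace (M ** (W ** transpose D)) = trace (transpose (D ** (W ** M)))"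
      by (simp add: matrix_transpose_mul symM symW matrix_mul_assoc)
    also have "\<dots> = trace (M ** (D ** W))"
      unfolding trace_transpose using trace_mul_sym[of "D ** W" M] by (simp add: matrix_mul_assoc)
    finally show ?thesis .
  qed
  moreover have "trace (M ** (b ** transpose d)) = trace (M ** (d ** transpose b))"
  proof -
    have "trace (M ** (b ** transpose d)) = trace (transpose (d ** transpose b ** M))"
      by (simp add: matrix_transpose_mul symM matrix_mul_assoc)
    also have "\<dots> = trace (M ** (d ** transpose b))"
      unfolding trace_transpose by (rule trace_mul_sym)
    finally show ?thesis .
  qed
  ultimately have "trace (M ** (D ** W + d ** transpose b)) = 0"
    by (simp add: matrix_add_ldistrib trace_add)
  also have "D ** W + d ** transpose b = J ** Y ** K"
    by (simp add: D_def d_def K_def matrix_add_ldistrib matrix_mul_assoc)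
  also have "trace (M ** (J ** Y ** K)) = trace (transpose (K ** M ** J) ** (K ** M ** J))"
    using trace_mul_sym[of "M ** J" "Y ** K"] by (simp add: matrix_mul_assoc flip: Y_def)
  finally have "K ** M ** J = 0"
    by (rule trace_transpose_mult_self_eq_0)
  then have "transpose (K ** M ** J) = 0"
    by (simp add: transpose_zero)
  \<comment> \<open>The transpose of \<open>K ** M ** J\<close> is the left-hand side of the third
    KKT equation; splitting \<open>M ** J\<close>, \<open>W ** J\<close> and \<open>b\<close> into
    blocks makes this visible.\<close>
  then have "transpose (M ** J) ** (W ** J ** transpose (calL L) + b ** transpose calE) = 0"
    by (simp add: K_def matrix_transpose_mul transpose_add symM symW matrix_mul_assoc)
  moreover have "M ** J = vcat (block12 M) (block22 M)" "W ** J = vcat (block12 W) (block22 W)"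
    unfolding J_def by (simp_all add: split_cols_lower symM symW)
  moreover have "transpose (block22 M) = block22 M"
    using symM by (simp add: vec_eq_iff block22_def transpose_def)
  ultimately have kkt3: "transpose (block12 M) ** B ** transpose calE
      + block22 M ** X ** calE ** transpose calE
      + transpose (block12 M) ** block12 W ** transpose (calL L)
      + block22 M ** block22 W ** transpose (calL L) = 0"
    by (simp add: transpose_vcat vcat_mult b_def hcat_mult_vcat matrix_add_ldistrib
        matrix_mul_assoc add_ac)
  have kkt2: "F ** W + W ** transpose F + calB B X = 0"
    using lyapW by (simp add: lyap_def)
  show ?thesis
    by (rule exI[of _ W], intro conjI symW kkt1[unfolded F_def Q_def] kkt2[unfolded F_def] kkt3)
qed

end
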